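(* Let $\mu$ be a probability measure on $\mathbb{R}^n$, let $\xi\sim\mu$, and fix a set $C\in\mathcal{C}_n$. Then the following hold. (i) The typical radius $r_\mu(C)$ is well-defined (i.e. the maximizer defining it is unique and finite) if and only if $\mathbf{E}_\mu\, h_{C\cap sB_2^n}(\xi)<\infty$ for some $s>0$. (ii) Whenever $r_\mu(C)$ is well-defined, $\|\Pi_C\|_{L^1(\mu)}\leq 2\,r_\mu(C)$.
   Context: $\mathcal{C}_n$ is the class of closed convex sets $C \subset \mathbb{R}^n$ containing the origin. $\Pi_C(x) = \arg\min_{y\in C}\|x-y\|_2$ is the metric projection, and $\|\Pi_C\|_{L^1(\mu)}=\mathbf{E}_{\xi\sim\mu}\|\Pi_C(\xi)\|_2$. $B_2^n$ is the closed Euclidean unit ball. The support function is $h_T(x)=\sup_{y\in T}\langle x,y\rangle$; it is nonnegative when $0\in T$, so its expectation is defined in $[0,\infty]$. The typical radius is $$r_\mu(C)=\arg\max_{r\geq0}\Big\{\mathbf{E}_\mu h_{C\cap rB_2^n}(\xi)-\frac{r^2}{2}\Big\}.$$ *)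

theory Defs
  imports "HOL-Probability.Probability"
begin

definition support_function :: "'a::real_inner set \<Rightarrow> 'a \<Rightarrow> ereal" where
  "support_function T x = (SUP y\<in>T. ereal (x \<bullet> y))"

text \<open>Meant for \<open>0 \<in> T\<close>: the support function is then nonnegative, so the truncation
  \<open>e2ennreal\<close> of negative values is harmless.\<close>

definition expected_support :: "'a::real_inner measure \<Rightarrow> 'a set \<Rightarrow> ennreal" where
  "expected_support \<mu> T = (\<integral>\<^sup>+ \<xi>. e2ennreal (support_function T \<xi>) \<partial>\<mu>)"

text \<open>The subtrahend is finite, so no \<open>\<infinity> - \<infinity>\<close> occurs; the value is \<open>\<infinity>\<close> exactly when the
  expectation is.\<close>

definition radius_objective :: "'a::real_inner measure \<Rightarrow> 'a set \<Rightarrow> real \<Rightarrow> ereal" where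
  "radius_objective \<mu> C r =
     enn2ereal (expected_support \<mu> (C \<inter> cball 0 r)) - ereal (r\<^sup>2 / 2)"

text \<open>Since \<open>r\<close> ranges over the reals, a maximizer is automatically finite. Points where the
  objective takes the value \<open>\<infinity>\<close> count as maximizers.\<close>

definition typical_radius_well_defined :: "'a::real_inner measure \<Rightarrow> 'a set \<Rightarrow> bool" where
  "typical_radius_well_defined \<mu> C \<longleftrightarrow>
     (\<exists>!r. is_arg_max (radius_objective \<mu> C) (\<lambda>r. 0 \<le> r) r)"

definition typical_radius :: "'a::real_inner measure \<Rightarrow> 'a set \<Rightarrow> real" where
  "typical_radius \<mu> C = arg_max (radius_objective \<mu> C) (\<lambda>r. 0 \<le> r)"

text \<open>The metric projection onto a closed convex set is the library's \<open>closest_point\<close>.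
  The norm takes values in \<open>[0, \<infinity>]\<close>; integrability is not presupposed.\<close>

definition projection_L1_norm :: "'a::euclidean_space measure \<Rightarrow> 'a set \<Rightarrow> ennreal" where
  "projection_L1_norm \<mu> C = (\<integral>\<^sup>+ \<xi>. ennreal (norm (closest_point C \<xi>)) \<partial>\<mu>)"

end

theory Submission
  imports Defs
begin

text \<open>Write \<open>F r\<close> for the expected support function of \<open>C \<inter> r B\<close>. Since \<open>C\<close> is convex and contains
  the origin, \<open>F\<close> is midpoint concave and \<open>F s \<le> F r \<le> (r / s) F s\<close> for \<open>0 < s \<le> r\<close>. So if \<open>F\<close> is
  finite at one positive radius, it is finite everywhere, continuous on the positive half-line, and
  of at most linear growth, while continuity at \<open>0\<close> is dominated convergence; hence
  \<open>F r - r\<^sup>2 / 2\<close> has exactly one maximizer. Otherwise the objective is \<open>\<infinity>\<close> at every positive radius.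

  For the bound, let \<open>p\<close> be the projection of \<open>x\<close>. Moving a point of \<open>C \<inter> r B\<close> towards \<open>p\<close> until
  the radius has grown by \<open>t\<close> shows that the support function gains at least \<open>t * norm p\<close>
  whenever \<open>norm p \<ge> r + t\<close>. Comparing the objective at the maximizer \<open>r\<close> and at \<open>r + t\<close>
  therefore bounds the expectation of \<open>norm p\<close> on \<open>norm p \<ge> r + t\<close> by \<open>r + t / 2\<close>; the
  remaining part is at most \<open>r + t\<close>. Let \<open>t\<close> tend to \<open>0\<close>.\<close>

section \<open>Support functions as suprema in the extended nonnegative reals\<close>

lemma e2ennreal_support_function:
  "e2ennreal (support_function T x) = (SUP y\<in>T. ennreal (x \<bullet> y))"
proof (rule antisym)
  have "ereal (x \<bullet> y) \<le> enn2ereal (SUP y\<in>T. ennreal (x \<bullet> y))" if "y \<in> T" for y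
  proof -
    have "ereal (x \<bullet> y) \<le> enn2ereal (ennreal (x \<bullet> y))"
      by (cases "0 \<le> x \<bullet> y") (auto simp: ennreal_neg zero_ennreal.rep_eq)
    also have "\<dots> \<le> enn2ereal (SUP y\<in>T. ennreal (x \<bullet> y))"
      using SUP_upper[OF that, of "\<lambda>y. ennreal (x \<bullet> y)"] by (simp add: less_eq_ennreal.rep_eq)
    finally show ?thesis .
  qed
  then have "support_function T x \<le> enn2ereal (SUP y\<in>T. ennreal (x \<bullet> y))"
    unfolding support_function_def by (intro SUP_least)
  then show "e2ennreal (support_function T x) \<le> (SUP y\<in>T. ennreal (x \<bullet> y))"
    by (metis e2ennreal_enn2ereal e2ennreal_mono)
next
  show "(SUP y\<in>T. ennreal (x \<bullet> y)) \<le> e2ennreal (support_function T x)"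
    by (intro SUP_least)
      (auto simp: support_function_def simp flip: e2ennreal_ereal intro!: e2ennreal_mono SUP_upper)
qed

lemma inner_le_e2ennreal_support_function:
  "y \<in> T \<Longrightarrow> ennreal (x \<bullet> y) \<le> e2ennreal (support_function T x)"
  unfolding e2ennreal_support_function by (rule SUP_upper)

text \<open>Compactness yields a maximizer, and comparing it with the point \<open>0\<close> makes
  the maximum nonnegative, so \<open>ennreal\<close> truncates nothing.\<close>

lemma support_function_attained:
  assumes "compact T" "0 \<in> T"
  obtains y where "y \<in> T" "0 \<le> x \<bullet> y" "e2ennreal (support_function T x) = ennreal (x \<bullet> y)"
proof -
  obtain y where y: "y \<in> T" "\<And>z. z \<in> T \<Longrightarrow> x \<bullet> z \<le> x \<bullet> y"
    using continuous_attains_sup[of T "\<lambda>y. x \<bullet> y"] assms by (force intro: continuous_intros)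
  moreover have "0 \<le> x \<bullet> y"
    using y(2)[OF assms(2)] by simp
  moreover have "e2ennreal (support_function T x) = ennreal (x \<bullet> y)"
    unfolding e2ennreal_support_function
    by (rule antisym) (auto intro!: SUP_least SUP_upper2[OF y(1)] ennreal_leI y(2))
  ultimately show thesis using that by blast
qed

text \<open>\<open>T\<close> may be uncountable, so countable suprema do not suffice. Instead the
  function is lower semicontinuous: each strict superlevel set is a union of open sets, one for each
  point of \<open>T\<close>.\<close>

lemma borel_measurable_support_function:
  "support_function T \<in> borel_measurable (borel :: 'a::real_inner measure)"
proof (rule borel_measurableI_greater)
  fix a :: ereal
  have "{x \<in> space borel. a < support_function T x} = (\<Union>y\<in>T. {x :: 'a. a < ereal (x \<bullet> y)})"
    by (auto simp: support_function_def less_SUP_iff)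
  also have "open \<dots>"
    by (intro open_UN ballI open_Collect_less continuous_intros)
  finally show "{x \<in> space borel. a < support_function T x} \<in> sets borel"
    by simp
qed

section \<open>Pointwise inequalities between support functions at different radii\<close>

locale prob_convex_set = prob_space \<mu> for \<mu> :: "'a::euclidean_space measure" +
  fixes C :: "'a set"
  assumes sets_borel: "sets \<mu> = sets borel"
    and closed: "closed C" and convex: "convex C" and zero_mem: "0 \<in> C"
begin

definition H :: "real \<Rightarrow> 'a \<Rightarrow> ennreal" where
  "H r x = e2ennreal (support_function (C \<inter> cball 0 r) x)"

definition F :: "real \<Rightarrow> ennreal" where
  "F r = expected_support \<mu> (C \<inter> cball 0 r)"

lemma F_eq: "F r = (\<integral>\<^sup>+ x. H r x \<partial>\<mu>)"
  by (simp add: F_def H_def expected_support_def)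

lemma measurable_H [measurable]: "H r \<in> borel_measurable \<mu>"
proof -
  have "H r \<in> borel_measurable borel"
    unfolding H_def[abs_def]
    by (intro measurable_compose[OF borel_measurable_support_function]) simp
  then show ?thesis
    using measurable_cong_sets[OF sets_borel refl] by blast
qed

lemma measurable_norm_closest_point [measurable]:
  "(\<lambda>x. norm (closest_point C x)) \<in> borel_measurable \<mu>"
proof -
  have "(\<lambda>x. norm (closest_point C x)) \<in> borel_measurable borel"
    using zero_mem closed convex
    by (intro borel_measurable_continuous_onI continuous_intros continuous_on_closest_point) auto
  then show ?thesis
    using measurable_cong_sets[OF sets_borel refl] by blast
qed

lemma inner_le_H: "y \<in> C \<Longrightarrow> norm y \<le> r \<Longrightarrow> ennreal (x \<bullet> y) \<le> H r x"
  unfolding H_def by (intro inner_le_e2ennreal_support_function) simp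

lemma H_attained:
  assumes "0 \<le> r"
  obtains y where "y \<in> C" "norm y \<le> r" "0 \<le> x \<bullet> y" "H r x = ennreal (x \<bullet> y)"
proof -
  have "compact (C \<inter> cball 0 r)"
    using closed by (simp add: closed_Int_compact)
  then show thesis
    using support_function_attained[of "C \<inter> cball 0 r" x] zero_mem assms that
    by (auto simp: H_def)
qed

lemma scaleR_mem: "y \<in> C \<Longrightarrow> 0 \<le> c \<Longrightarrow> c \<le> 1 \<Longrightarrow> c *\<^sub>R y \<in> C"
  using convexD[OF convex zero_mem, of y "1 - c" c] by simp

lemma H_mono: "0 \<le> r \<Longrightarrow> r \<le> s \<Longrightarrow> H r x \<le> H s x"
  by (rule H_attained[of r x]) (auto intro: inner_le_H)

text \<open>Shrink a maximizer for radius \<open>r\<close> by the factor \<open>s / r\<close>;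
  convexity and \<open>0 \<in> C\<close> keep it in \<open>C\<close>.\<close>

lemma H_scale:
  assumes "0 < s" "s \<le> r"
  shows "H r x \<le> ennreal (r / s) * H s x"
proof -
  obtain y where y: "y \<in> C" "norm y \<le> r" "0 \<le> x \<bullet> y" "H r x = ennreal (x \<bullet> y)"
    using H_attained[of r x] assms by auto
  have "ennreal (x \<bullet> ((s / r) *\<^sub>R y)) \<le> H s x"
    using assms y by (intro inner_le_H scaleR_mem) (auto simp: field_simps)
  then have "ennreal (r / s) * ennreal (x \<bullet> ((s / r) *\<^sub>R y)) \<le> ennreal (r / s) * H s x"
    by (rule mult_left_mono) simp
  then show ?thesis
    using assms y by (simp flip: ennreal_mult')
qed

lemma H_le_norm: "0 \<le> r \<Longrightarrow> H r x \<le> ennreal (r * norm x)"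
proof -
  assume "0 \<le> r"
  then obtain y where y: "norm y \<le> r" "H r x = ennreal (x \<bullet> y)"
    using H_attained[of r x] by auto
  have "x \<bullet> y \<le> norm x * norm y"
    by (rule norm_cauchy_schwarz)
  also have "\<dots> \<le> r * norm x"
    using y by (metis mult.commute mult_left_mono norm_ge_zero)
  finally show ?thesis
    using y by (simp add: ennreal_leI)
qed

text \<open>The midpoint of maximizers for the two radii is admissible for the average
  radius.\<close>

lemma H_midpoint:
  assumes "0 \<le> r" "0 \<le> s"
  shows "H r x + H s x \<le> 2 * H ((r + s) / 2) x"
proof -
  obtain y where y: "y \<in> C" "norm y \<le> r" "0 \<le> x \<bullet> y" "H r x = ennreal (x \<bullet> y)"
    using H_attained[of r x] assms by auto
  obtain z where z: "z \<in> C" "norm z \<le> s" "0 \<le> x \<bullet> z" "H s x = ennreal (x \<bullet> z)"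
    using H_attained[of s x] assms by auto
  let ?w = "(1/2) *\<^sub>R y + (1/2) *\<^sub>R z"
  have "norm ?w \<le> (r + s) / 2"
    using norm_triangle_ineq[of "(1/2) *\<^sub>R y" "(1/2) *\<^sub>R z"] y z by simp
  moreover have "?w \<in> C"
    using y z by (intro convexD[OF convex]) auto
  ultimately have "2 * ennreal (x \<bullet> ?w) \<le> 2 * H ((r + s) / 2) x"
    by (intro mult_left_mono inner_le_H) auto
  moreover have "2 * ennreal (x \<bullet> ?w) = ennreal (2 * (x \<bullet> ?w))"
    using ennreal_mult'[of 2 "x \<bullet> ?w"] by simp
  moreover have "2 * (x \<bullet> ?w) = x \<bullet> y + x \<bullet> z"
    by (simp add: inner_add_right)
  ultimately show ?thesis
    using y z by (simp add: ennreal_plus)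
qed

lemma H_gain:
  assumes "0 \<le> r" "0 < t" "r + t \<le> norm (closest_point C x)"
  shows "H r x + ennreal (t * norm (closest_point C x)) \<le> H (r + t) x"
proof -
  define p where "p = closest_point C x"
  \<comment> \<open>\<open>l\<close> solves \<open>(1 - l) * r + l * norm p = r + t\<close>. It lies
    in the unit interval because \<open>norm p - r\<close> is at least \<open>t > 0\<close>.\<close>
  define l where "l = t / (norm p - r)"
  obtain q where q: "q \<in> C" "norm q \<le> r" "0 \<le> x \<bullet> q" "H r x = ennreal (x \<bullet> q)"
    using H_attained[of r x] assms by auto
  have pC: "p \<in> C"
    unfolding p_def using closed zero_mem by (intro closest_point_in_set) auto
  have np: "r + t \<le> norm p" using assms p_def by simp
  then have l: "0 \<le> l" "l \<le> 1" "l * (norm p - r) = t"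
    using assms by (auto simp: l_def)
  let ?z = "(1 - l) *\<^sub>R q + l *\<^sub>R p"
  have zC: "?z \<in> C"
    using l q pC by (intro convexD[OF convex]) auto
  have "norm ?z \<le> (1 - l) * norm q + l * norm p"
    using norm_triangle_ineq[of "(1 - l) *\<^sub>R q" "l *\<^sub>R p"] l by simp
  also have "\<dots> \<le> (1 - l) * r + l * norm p"
    using q l by (intro add_right_mono mult_left_mono) auto
  also have "\<dots> = r + t" using l by (simp add: algebra_simps)
  finally have nz: "norm ?z \<le> r + t" .
  \<comment> \<open>The variational inequality for the projection gives
    \<open>x \<bullet> (p - q) \<ge> p \<bullet> (p - q)\<close>; Cauchy-Schwarz bounds the right
    side below by \<open>norm p * (norm p - r)\<close>, whose second factor cancels against
    \<open>l\<close>.\<close>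
  have "(x - p) \<bullet> (q - p) \<le> 0"
    unfolding p_def using closed convex q by (intro closest_point_dot) auto
  moreover have "p \<bullet> q \<le> norm p * r"
    using norm_cauchy_schwarz[of p q] q
    by (meson mult_left_mono norm_ge_zero order_trans)
  ultimately have "norm p * (norm p - r) \<le> x \<bullet> (p - q)"
    by (simp add: algebra_simps inner_diff power2_norm_eq_inner power2_eq_square[symmetric] inner_commute)
  then have "l * (norm p * (norm p - r)) \<le> l * (x \<bullet> (p - q))"
    using l by (intro mult_left_mono) auto
  moreover have "l * (norm p * (norm p - r)) = t * norm p"
    using l(3) by (metis mult.left_commute mult.commute)
  moreover have "x \<bullet> ?z = x \<bullet> q + l * (x \<bullet> (p - q))"
    by (simp add: algebra_simps)
  ultimately have "x \<bullet> q + t * norm p \<le> x \<bullet> ?z" by simp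
  then have "ennreal (x \<bullet> q + t * norm p) \<le> ennreal (x \<bullet> ?z)"
    by (rule ennreal_leI)
  also have "\<dots> \<le> H (r + t) x"
    using zC nz by (rule inner_le_H)
  finally show ?thesis
    using q assms by (simp add: ennreal_plus p_def)
qed

section \<open>Integrated inequalities, and necessity of finiteness\<close>

lemma F_mono: "0 \<le> r \<Longrightarrow> r \<le> s \<Longrightarrow> F r \<le> F s"
  unfolding F_eq by (intro nn_integral_mono H_mono)

lemma F_scale: "0 < s \<Longrightarrow> s \<le> r \<Longrightarrow> F r \<le> ennreal (r / s) * F s"
  unfolding F_eq by (subst nn_integral_cmult[symmetric]) (auto intro!: nn_integral_mono H_scale)

lemma F_midpoint: "0 \<le> r \<Longrightarrow> 0 \<le> s \<Longrightarrow> F r + F s \<le> 2 * F ((r + s) / 2)"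
  unfolding F_eq
  by (subst nn_integral_cmult[symmetric], simp, subst nn_integral_add[symmetric])
    (auto intro!: nn_integral_mono H_midpoint)

lemma F_0: "F 0 = 0"
  using H_le_norm[of 0] by (simp add: F_eq)

lemma F_finite:
  assumes "0 < s" "F s < \<infinity>" "0 \<le> r"
  shows "F r < \<infinity>"
proof (cases "r \<le> s")
  case True
  then show ?thesis using F_mono[OF assms(3)] assms(2) by (meson order_le_less_trans)
next
  case False
  then have "F r \<le> ennreal (r / s) * F s" using assms by (intro F_scale) auto
  also have "\<dots> < \<infinity>" using assms by (simp add: ennreal_mult_less_top)
  finally show ?thesis .
qed

lemma objective_eq: "radius_objective \<mu> C r = enn2ereal (F r) - ereal (r\<^sup>2 / 2)"
  by (simp add: radius_objective_def F_def)

text \<open>What fails otherwise is uniqueness, not existence: all positive radii tie at the value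
  \<open>\<infinity>\<close>, in particular \<open>1\<close> and \<open>2\<close>.\<close>

lemma finite_of_well_defined:
  assumes "typical_radius_well_defined \<mu> C"
  shows "\<exists>s>0. F s < \<infinity>"
proof (rule ccontr)
  assume "\<not> ?thesis"
  then have "F s = \<infinity>" if "0 < s" for s
    using that by (auto simp: less_top[symmetric])
  then have "radius_objective \<mu> C s = \<infinity>" if "0 < s" for s
    using that by (simp add: objective_eq)
  then have "is_arg_max (radius_objective \<mu> C) (\<lambda>r. 0 \<le> r) s" if "0 < s" for s
    using that by (auto simp: is_arg_max_def)
  from this[of 1] this[of 2] have "(1::real) = 2"
    using assms unfolding typical_radius_well_defined_def by (elim ex1E) (metis zero_less_numeral zero_less_one)
  then show False by simp
qed

end

section \<open>Continuity of the expected support function in the finite case\<close>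

locale finite_prob_convex_set = prob_convex_set +
  assumes ex_finite: "\<exists>s>0. F s < \<infinity>"
begin

text \<open>\<open>enn2real\<close> sends \<open>\<infinity>\<close> to \<open>0\<close>, so
  \<open>f\<close> is faithful only where \<open>F\<close> is finite; \<open>F_finite\<close>
  ensures this at every nonnegative radius.\<close>

definition f :: "real \<Rightarrow> real" where
  "f r = enn2real (F r)"

lemma F_eq_f: "0 \<le> r \<Longrightarrow> F r = ennreal (f r)"
  using ex_finite F_finite by (auto simp: f_def)

lemma f_nonneg: "0 \<le> f r"
  by (simp add: f_def)

lemma objective_f: "0 \<le> r \<Longrightarrow> radius_objective \<mu> C r = ereal (f r - r\<^sup>2 / 2)"
  by (simp add: objective_eq F_eq_f f_nonneg)

lemma f_0: "f 0 = 0"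
  by (simp add: f_def F_0)

lemma f_mono: "0 \<le> r \<Longrightarrow> r \<le> s \<Longrightarrow> f r \<le> f s"
  using F_mono[of r s] by (simp add: F_eq_f f_nonneg)

text \<open>Equivalently, \<open>f r / r\<close> is nonincreasing on the positive half-line.\<close>

lemma f_scale: "0 < s \<Longrightarrow> s \<le> r \<Longrightarrow> f r \<le> r / s * f s"
  using F_scale[of s r] by (simp add: F_eq_f f_nonneg flip: ennreal_mult)

lemma f_midpoint:
  assumes "0 \<le> r" "0 \<le> s"
  shows "f r + f s \<le> 2 * f ((r + s) / 2)"
proof -
  have "ennreal (f r + f s) \<le> ennreal (2 * f ((r + s) / 2))"
    using F_midpoint[OF assms] assms by (simp add: F_eq_f f_nonneg ennreal_plus ennreal_mult)
  then show ?thesis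
    by (subst (asm) ennreal_le_iff) (simp_all add: f_nonneg)
qed

text \<open>The scaling bound degenerates at radius \<open>0\<close>, so integrability enters here:
  \<open>H 1\<close> dominates along the radii \<open>u n\<close>, and Cauchy-Schwarz gives
  pointwise convergence.\<close>

lemma f_tendsto_0: "(f \<longlongrightarrow> 0) (at 0 within {0..})"
proof -
  define u where "u n = 1 / real (Suc n)" for n
  have u: "0 < u n" "u n \<le> 1" for n by (auto simp: u_def)
  have "(\<lambda>n. \<integral>\<^sup>+ x. H (u n) x \<partial>\<mu>) \<longlonglongrightarrow> (\<integral>\<^sup>+ x. 0 \<partial>\<mu>)"
  proof (rule nn_integral_dominated_convergence[where w = "H 1"])
    show "(\<integral>\<^sup>+ x. H 1 x \<partial>\<mu>) < \<infinity>"
      using F_eq_f[of 1] by (simp add: F_eq[symmetric])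
    have "(\<lambda>n. H (u n) x) \<longlonglongrightarrow> 0" for x
    proof (rule tendsto_sandwich[of "\<lambda>_. 0" _ _ "\<lambda>n. ennreal (u n * norm x)"])
      have "(\<lambda>n. ennreal (u n * norm x)) \<longlonglongrightarrow> ennreal (0 * norm x)"
        unfolding u_def using LIMSEQ_Suc[OF lim_1_over_n]
        by (intro tendsto_ennrealI tendsto_mult tendsto_const)
      then show "(\<lambda>n. ennreal (u n * norm x)) \<longlonglongrightarrow> 0" by simp
    qed (use u in \<open>auto intro!: always_eventually H_le_norm simp: less_imp_le\<close>)
    then show "AE x in \<mu>. (\<lambda>n. H (u n) x) \<longlonglongrightarrow> 0" by simp
  qed (use u in \<open>auto intro!: H_mono simp: less_imp_le\<close>)
  then have lim: "(\<lambda>n. F (u n)) \<longlonglongrightarrow> 0" by (simp add: F_eq)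
  show ?thesis
  proof (rule tendstoI)
    fix e :: real assume "0 < e"
    then have "\<forall>\<^sub>F n in sequentially. F (u n) < ennreal e"
      by (intro order_tendstoD[OF lim]) simp
    \<comment> \<open>A single small radius suffices, since monotonicity controls all smaller
      ones.\<close>
    then obtain n where "F (u n) < ennreal e"
      by (auto simp: eventually_sequentially)
    then have n: "f (u n) < e"
      using u[of n] by (simp add: F_eq_f f_nonneg less_imp_le ennreal_less_iff)
    have "\<forall>\<^sub>F r in at 0 within {0..}. r < u n"
      using u(1)[of n] by (intro order_tendstoD(2)[OF tendsto_ident_at])
    moreover have "\<forall>\<^sub>F r in at 0 within {0..}. r \<in> {0::real..}"
      by (simp add: eventually_at_filter)
    ultimately show "\<forall>\<^sub>F r in at 0 within {0..}. dist (f r) 0 < e"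
    proof eventually_elim
      case (elim r)
      then show ?case using f_mono[of r "u n"] n by (simp add: f_nonneg)
    qed
  qed
qed

lemma continuous_on_f: "continuous_on {0..} f"
  unfolding continuous_on_def
proof
  fix r :: real assume "r \<in> {0..}"
  show "(f \<longlongrightarrow> f r) (at r within {0..})"
  proof (cases "r = 0")
    case True
    then show ?thesis using f_tendsto_0 f_0 by simp
  next
    case False
    then have r: "0 < r" using \<open>r \<in> {0..}\<close> by simp
    have ev: "\<forall>\<^sub>F s in at r within {0..}. 0 < s"
      by (intro order_tendstoD(1)[OF tendsto_ident_at r])
    show ?thesis
    \<comment> \<open>Monotonicity and scaling each bound \<open>f s\<close> on either side of
      \<open>r\<close>; \<open>min\<close> and \<open>max\<close> merge the two cases into envelopes
      that agree at \<open>s = r\<close>.\<close>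
    proof (rule tendsto_sandwich)
      show "\<forall>\<^sub>F s in at r within {0..}. min 1 (s / r) * f r \<le> f s"
        using ev
      proof eventually_elim
        case (elim s)
        show ?case
        proof (cases "s \<le> r")
          case True
          then have "f r \<le> r / s * f s" using f_scale[of s r] elim by simp
          then show ?thesis using True r elim by (simp add: field_simps)
        next
          case False
          then show ?thesis using f_mono[of r s] r by simp
        qed
      qed
      show "\<forall>\<^sub>F s in at r within {0..}. f s \<le> max 1 (s / r) * f r"
        using ev
      proof eventually_elim
        case (elim s)
        show ?case
        proof (cases "s \<le> r")
          case True
          then show ?thesis using f_mono[of s r] r elim by (simp add: max_def)
        next
          case False
          then show ?thesis using f_scale[of r s] r by (simp add: max_def)
        qed
      qed
      have "((\<lambda>s. min 1 (s / r) * f r) \<longlongrightarrow> min 1 (r / r) * f r) (at r within {0..})"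
        using r by (intro tendsto_intros) simp
      then show "((\<lambda>s. min 1 (s / r) * f r) \<longlongrightarrow> f r) (at r within {0..})" using r by simp
      have "((\<lambda>s. max 1 (s / r) * f r) \<longlongrightarrow> max 1 (r / r) * f r) (at r within {0..})"
        using r by (intro tendsto_intros) simp
      then show "((\<lambda>s. max 1 (s / r) * f r) \<longlongrightarrow> f r) (at r within {0..})" using r by simp
    qed
  qed
qed

section \<open>Existence and uniqueness of the maximizer\<close>

lemma is_arg_max_iff:
  "is_arg_max (radius_objective \<mu> C) (\<lambda>r. 0 \<le> r) r \<longleftrightarrow>
     0 \<le> r \<and> (\<forall>s\<ge>0. f s - s\<^sup>2 / 2 \<le> f r - r\<^sup>2 / 2)"
  by (auto simp: is_arg_max_linorder objective_f)

lemma ex_maximizer: "\<exists>r\<ge>0. \<forall>s\<ge>0. f s - s\<^sup>2 / 2 \<le> f r - r\<^sup>2 / 2"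
proof -
  \<comment> \<open>Beyond \<open>R\<close> the objective is at most its value \<open>0\<close> at
    the origin: \<open>f s \<le> s * f 1\<close> and \<open>2 * f 1 \<le> s\<close>. The summand
    \<open>1\<close> gives \<open>R \<ge> 1\<close>, as scaling from radius \<open>1\<close>
    requires.\<close>
  define R where "R = 1 + 2 * f 1"
  have R: "1 \<le> R" by (simp add: R_def f_nonneg)
  have "continuous_on {0..R} (\<lambda>r. f r - r\<^sup>2 / 2)"
    by (intro continuous_intros continuous_on_subset[OF continuous_on_f]) auto
  then obtain r where r: "r \<in> {0..R}" "\<And>s. s \<in> {0..R} \<Longrightarrow> f s - s\<^sup>2 / 2 \<le> f r - r\<^sup>2 / 2"
    using continuous_attains_sup[of "{0..R}"] R by force
  have "f s - s\<^sup>2 / 2 \<le> f r - r\<^sup>2 / 2" if "0 \<le> s" for s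
  proof (cases "s \<le> R")
    case True
    then show ?thesis using r that by simp
  next
    case False
    then have "f s \<le> s * f 1" using f_scale[of 1 s] R by simp
    also have "\<dots> \<le> s * (s / 2)"
      using False that by (intro mult_left_mono) (auto simp: R_def)
    also have "\<dots> = s\<^sup>2 / 2" by (simp add: power2_eq_square)
    finally show ?thesis using r(2)[of 0] R f_0 by simp
  qed
  then show ?thesis using r(1) by auto
qed

text \<open>Strict concavity comes from the quadratic term: at the midpoint the objective exceeds
  the average of its two values by at least \<open>(r - r')\<^sup>2 / 8\<close>.\<close>

lemma maximizer_unique:
  assumes "0 \<le> r" "\<forall>s\<ge>0. f s - s\<^sup>2 / 2 \<le> f r - r\<^sup>2 / 2"
    and "0 \<le> r'" "\<forall>s\<ge>0. f s - s\<^sup>2 / 2 \<le> f r' - r'\<^sup>2 / 2"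
  shows "r = r'"
proof -
  let ?m = "(r + r') / 2"
  have "f ?m - ?m\<^sup>2 / 2 \<le> f r - r\<^sup>2 / 2" "f ?m - ?m\<^sup>2 / 2 \<le> f r' - r'\<^sup>2 / 2"
    using assms by auto
  moreover have "f r + f r' \<le> 2 * f ?m"
    using assms by (intro f_midpoint)
  moreover have "r\<^sup>2 / 2 + r'\<^sup>2 / 2 - ?m\<^sup>2 = (r - r')\<^sup>2 / 4"
    by (simp add: power2_eq_square field_simps)
  ultimately have "(r - r')\<^sup>2 \<le> 0" by linarith
  then show ?thesis by simp
qed

lemma well_defined: "typical_radius_well_defined \<mu> C"
  unfolding typical_radius_well_defined_def is_arg_max_iff
  using ex_maximizer maximizer_unique by blast

section \<open>The bound on the mean norm of the projection\<close>

lemma projection_le_of_maximizer: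
  assumes r: "0 \<le> r" and max: "\<And>s. 0 \<le> s \<Longrightarrow> f s - s\<^sup>2 / 2 \<le> f r - r\<^sup>2 / 2"
    and t: "0 < t"
  shows "projection_L1_norm \<mu> C \<le> ennreal (2 * r + 3 / 2 * t)"
proof -
  let ?p = "\<lambda>x. norm (closest_point C x)"
  define g where "g x = (if r + t \<le> ?p x then ennreal (?p x) else 0)" for x
  have [measurable]: "g \<in> borel_measurable \<mu>"
    unfolding g_def[abs_def] by measurable
  have "F r + ennreal t * (\<integral>\<^sup>+ x. g x \<partial>\<mu>) = (\<integral>\<^sup>+ x. H r x + ennreal t * g x \<partial>\<mu>)"
    by (simp add: F_eq nn_integral_add nn_integral_cmult)
  also have "\<dots> \<le> F (r + t)"
    unfolding F_eq
  proof (rule nn_integral_mono)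
    fix x
    show "H r x + ennreal t * g x \<le> H (r + t) x"
      using H_gain[OF r t, of x] H_mono[OF r, of "r + t" x] t
      by (auto simp: g_def ennreal_mult)
  qed
  finally have le: "ennreal (f r) + ennreal t * (\<integral>\<^sup>+ x. g x \<partial>\<mu>) \<le> ennreal (f (r + t))"
    using r t by (simp add: F_eq_f)
  \<comment> \<open>Maximality bounds the increment of \<open>f\<close> by
    \<open>((r + t)\<^sup>2 - r\<^sup>2) / 2\<close>, which is divisible by
    \<open>t\<close>.\<close>
  have "f (r + t) \<le> f r + t * (r + t / 2)"
    using max[of "r + t"] r t by (simp add: power2_eq_square field_simps)
  then have "ennreal (f (r + t)) \<le> ennreal (f r) + ennreal (t * (r + t / 2))"
    using r t by (subst ennreal_plus[symmetric]) (auto intro: ennreal_leI f_nonneg)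
  with le have "ennreal (f r) + ennreal t * (\<integral>\<^sup>+ x. g x \<partial>\<mu>) \<le> ennreal (f r) + ennreal (t * (r + t / 2))"
    by (rule order_trans)
  \<comment> \<open>Cancellation in \<open>ennreal\<close> is legitimate because
    \<open>ennreal (f r)\<close> is finite.\<close>
  then have "ennreal t * (\<integral>\<^sup>+ x. g x \<partial>\<mu>) \<le> ennreal t * ennreal (r + t / 2)"
    using r t by (simp add: ennreal_mult)
  then have g: "(\<integral>\<^sup>+ x. g x \<partial>\<mu>) \<le> ennreal (r + t / 2)"
    using t by (simp add: ennreal_mult_le_mult_iff)
  have "projection_L1_norm \<mu> C \<le> (\<integral>\<^sup>+ x. ennreal (r + t) + g x \<partial>\<mu>)"
    unfolding projection_L1_norm_def
    by (rule nn_integral_mono) (auto simp: g_def intro: ennreal_leI)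
  also have "\<dots> = ennreal (r + t) + (\<integral>\<^sup>+ x. g x \<partial>\<mu>)"
    \<comment> \<open>Total mass one makes the constant integrate to itself.\<close>
    by (simp add: nn_integral_add emeasure_space_1)
  also have "\<dots> \<le> ennreal (r + t) + ennreal (r + t / 2)"
    using g by (rule add_left_mono)
  also have "\<dots> = ennreal (2 * r + 3 / 2 * t)"
    using r t by (subst ennreal_plus[symmetric]) (auto simp: field_simps)
  finally show ?thesis .
qed

lemma projection_le_typical_radius: "projection_L1_norm \<mu> C \<le> ennreal (2 * typical_radius \<mu> C)"
proof -
  define r where "r = typical_radius \<mu> C"
  \<comment> \<open>\<open>arg_max\<close> is a Hilbert choice, so existence of a maximizer is what
    makes the chosen value one.\<close>
  have "is_arg_max (radius_objective \<mu> C) (\<lambda>r. 0 \<le> r) r"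
    using well_defined someI_ex[of "is_arg_max (radius_objective \<mu> C) (\<lambda>r. 0 \<le> r)"]
    unfolding r_def typical_radius_def arg_max_def typical_radius_well_defined_def by blast
  then have r: "0 \<le> r" "\<And>s. 0 \<le> s \<Longrightarrow> f s - s\<^sup>2 / 2 \<le> f r - r\<^sup>2 / 2"
    by (auto simp: is_arg_max_iff)
  have "projection_L1_norm \<mu> C \<le> ennreal (2 * r)"
  proof (rule ennreal_le_epsilon)
    fix e :: real assume "0 < e"
    \<comment> \<open>Taking \<open>t = 2 / 3 * e\<close> turns the error \<open>3 / 2 * t\<close>
      into exactly \<open>e\<close>.\<close>
    then have "projection_L1_norm \<mu> C \<le> ennreal (2 * r + 3 / 2 * (2 / 3 * e))"
      using r by (intro projection_le_of_maximizer) auto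
    also have "\<dots> = ennreal (2 * r) + ennreal e"
      using r(1) \<open>0 < e\<close> by (simp add: ennreal_plus)
    finally show "projection_L1_norm \<mu> C \<le> ennreal (2 * r) + ennreal e" .
  qed
  then show ?thesis by (simp add: r_def)
qed

end

theorem proposition1p6:
  fixes \<mu> :: "(real ^ 'n) measure" and C :: "(real ^ 'n) set"
  assumes "prob_space \<mu>" and "sets \<mu> = sets borel"
    and "closed C" and "convex C" and "0 \<in> C"
  shows "(typical_radius_well_defined \<mu> C \<longleftrightarrow>
            (\<exists>s>0. expected_support \<mu> (C \<inter> cball 0 s) < \<infinity>)) \<and>
         (typical_radius_well_defined \<mu> C \<longrightarrow>
            projection_L1_norm \<mu> C \<le> ennreal (2 * typical_radius \<mu> C))"
proof -
  interpret prob_convex_set \<mu> C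
    using assms by (simp add: prob_convex_set_def prob_convex_set_axioms_def)
  have fin: "finite_prob_convex_set \<mu> C" if "\<exists>s>0. F s < \<infinity>"
    using that by unfold_locales
  show ?thesis
    \<comment> \<open>The second claim passes through the first: well-definedness yields the finite
      radius under which the bound was proved.\<close>
    using finite_of_well_defined finite_prob_convex_set.well_defined[OF fin]
      finite_prob_convex_set.projection_le_typical_radius[OF fin]
    unfolding F_def by blast
qed

end
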